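(* Let $r\in(-1,0)$, $\rho>0$, and let $v_1,v_2\ge 0$ be real numbers with $v_1\neq v_2$. Let $f:[0,\infty)\to[0,\infty)$ be defined by $f(x)=(1+r)x+v_1$ if $x<\rho$ and $f(x)=(1+r)x+v_2$ if $x\ge\rho$. For each $S_0\ge 0$, let the financial time series $(S_n)_{n\ge 0}$ with initial value $S_0$ be the sequence defined by $S_n=f(S_{n-1})$ for $n\ge 1$. Then one of the following alternatives occurs: (i) the financial time series are asymptotic to at most two periodic sequences, that is, there is a collection of at most two periodic sequences such that, for every $S_0\ge 0$, the financial time series $(S_n)_{n\ge 0}$ is asymptotic to a periodic sequence of the collection; (ii) the financial time series have the same Cantor set as their $\omega$-limit set, that is, there is a Cantor set $C$ such that, for every $S_0\ge 0$, the $\omega$-limit set of $(S_n)_{n\ge 0}$ equals $C$.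
   Context: A sequence $(a_n)_{n\ge 0}$ is periodic if $a_{i+n}=a_i$ for some $n\ge 1$ and all $i\ge 0$. A sequence $(b_n)_{n\ge 0}$ is asymptotic to a sequence $(a_n)_{n\ge 0}$ if $\lim_{n\to\infty}|b_n-a_n|=0$. The $\omega$-limit set of a real sequence $(S_n)_{n\ge 0}$ is the set of all $p\in\mathbb{R}$ for which there exist $n_1<n_2<n_3<\cdots$ such that $\lim_{k\to\infty}S_{n_k}=p$. A Cantor set is a compact, perfect, nowhere dense set.
   Formalization: In (i), periodic sequences are counted up to a shift of the index: each series is asymptotic to some shift of a member of the collection. Without this the claim fails: r=-1/2, ρ=1, v1=3/5, v2=0 has the 3-cycle 6/7, 36/35, 18/35. *)

theory Defs
  imports "HOL-Analysis.Analysis"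
begin

definition periodic_seq :: "(nat \<Rightarrow> real) \<Rightarrow> bool" where
  "periodic_seq a \<longleftrightarrow> (\<exists>n\<ge>1. \<forall>i. a (i + n) = a i)"

definition asymptotic_to :: "(nat \<Rightarrow> real) \<Rightarrow> (nat \<Rightarrow> real) \<Rightarrow> bool" where
  "asymptotic_to b a \<longleftrightarrow> (\<lambda>n. \<bar>b n - a n\<bar>) \<longlonglongrightarrow> 0"

(* Periodic sequences are counted up to a shift of the index.  A periodic orbit of exact
   period q is traversed by q different sequences, according to the starting point, and no
   two of them are asymptotic to each other.  Hence a family of orbits can be asymptotic to
   at most two periodic sequences only if a sequence and its shifts count as one. *)
definition asymptotic_up_to_shift :: "(nat \<Rightarrow> real) \<Rightarrow> (nat \<Rightarrow> real) \<Rightarrow> bool" where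
  "asymptotic_up_to_shift b a \<longleftrightarrow> (\<exists>k. asymptotic_to b (\<lambda>n. a (n + k)))"

definition omega_limit_set :: "(nat \<Rightarrow> real) \<Rightarrow> real set" where
  "omega_limit_set S = {p. \<exists>n :: nat \<Rightarrow> nat. strict_mono n \<and> (\<lambda>k. S (n k)) \<longlonglongrightarrow> p}"

(* The empty set is not excluded.  It makes no difference for the omega-limit set of a
   bounded real sequence, which is never empty. *)
definition cantor_set :: "real set \<Rightarrow> bool" where
  "cantor_set C \<longleftrightarrow> compact C \<and> (\<forall>x\<in>C. x islimpt C) \<and> interior (closure C) = {}"

(* Only the values at x \<ge> 0 matter: for v1, v2 \<ge> 0 and r > -1 the map sends [0, \<infinity>) to itself. *)
definition wealth_map :: "real \<Rightarrow> real \<Rightarrow> real \<Rightarrow> real \<Rightarrow> real \<Rightarrow> real" where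
  "wealth_map r \<rho> v1 v2 x = (if x < \<rho> then (1 + r) * x + v1 else (1 + r) * x + v2)"

primrec financial_series ::
    "real \<Rightarrow> real \<Rightarrow> real \<Rightarrow> real \<Rightarrow> real \<Rightarrow> nat \<Rightarrow> real" where
  "financial_series r \<rho> v1 v2 S0 0 = S0"
| "financial_series r \<rho> v1 v2 S0 (Suc n) =
     wealth_map r \<rho> v1 v2 (financial_series r \<rho> v1 v2 S0 n)"

end

theory Submission
  imports Defs
begin

text \<open>
  Write \<open>lam = 1 + r\<close>. Both branches of the map are contractions with factor \<open>lam\<close>, so two orbits
  that visit the two sides of \<open>\<rho>\<close> in the same order from some time on approach each other. The
  asymptotic behaviour is therefore a matter of the side sequence alone.

  If \<open>lam * \<rho> + v1 \<le> \<rho>\<close>, then \<open>{x. x < \<rho>}\<close> is invariant, and if \<open>\<rho> \<le> lam * \<rho> + v2\<close>, then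
  \<open>{x. \<rho> \<le> x}\<close> is. In either case every orbit stays on one side eventually, and converges to the
  fixed point \<open>v1 / (- r)\<close> or \<open>v2 / (- r)\<close> of the corresponding branch. These are the two constant
  sequences of the first alternative.

  Otherwise \<open>v2 < v1\<close>, every orbit enters \<open>[a, b)\<close> with \<open>a = lam * \<rho> + v2\<close> and
  \<open>b = lam * \<rho> + v1\<close>, and there the map is a contracted rotation: after identifying \<open>a\<close> with \<open>b\<close>
  it lifts to an increasing map \<open>F\<close> of the line with \<open>F (x + 1) = F x + 1\<close>, and the orbit is at or
  above \<open>\<rho>\<close> exactly when the integer part of the lifted orbit increases. For any increasing map of
  degree one these integer parts are eventually those of a rotation,
  \<open>\<lfloor>(F ^^ n) x\<rfloor> = \<lfloor>y + n * \<theta>\<rfloor>\<close> with \<open>\<theta>\<close> independent of \<open>x\<close> (\<open>monotone_lift_codes\<close>).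
  The side sequence being known, solving the affine recursion backwards in time gives an explicit
  function \<open>\<Psi>\<close> of period one (\<open>coded_orbit\<close>) such that \<open>S n - \<Psi> (y + n * \<theta>)\<close> tends to 0
  (\<open>financial_series_asymptotic_coded_orbit\<close>).

  If \<open>\<theta>\<close> is rational, the sequences \<open>\<Psi> (y + n * \<theta>)\<close> are all shifts of a single periodic one. If
  \<open>\<theta>\<close> is irrational, density of the rotation and right-continuity of \<open>\<Psi>\<close> show that every
  \<open>\<omega>\<close>-limit set is \<open>C = closure (range \<Psi>)\<close>. It is compact because \<open>\<Psi>\<close> is bounded, and
  perfect because \<open>\<Psi>\<close> is right-continuous and strictly increasing on \<open>[0, 1)\<close>. Finally \<open>C\<close> is
  covered by the image of its part below \<open>\<rho>\<close> and the image of its part above \<open>\<rho>\<close>, each scaled by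
  \<open>lam < 1\<close>, so its Lebesgue measure \<open>m\<close> satisfies \<open>m \<le> lam * m\<close>. Hence \<open>m = 0\<close> and \<open>C\<close> has
  empty interior.
\<close>

section \<open>Integer parts along orbits of increasing maps of degree one\<close>

lemma degree_one_funpow_shift:
  fixes F :: "real \<Rightarrow> real"
  assumes "\<And>x. F (x + 1) = F x + 1"
  shows "(F ^^ n) (x + of_int k) = (F ^^ n) x + of_int k"
proof -
  have nat_shift: "F (x + real m) = F x + real m" for x m
  proof (induction m)
    case (Suc m)
    have "F (x + real (Suc m)) = F ((x + real m) + 1)"
      by (simp add: add_ac)
    with Suc show ?case
      by (simp only: assms)
  qed simp
  have shift: "F (x + of_int k) = F x + of_int k" for x
  proof (cases "k \<ge> 0")
    case True
    then show ?thesis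
      using nat_shift[of x "nat k"] by simp
  next
    case False
    then show ?thesis
      using nat_shift[of "x + of_int k" "nat (- k)"] by simp
  qed
  show ?thesis
    by (induction n) (simp_all add: shift)
qed

lemma funpow_mult_lower:
  fixes F :: "real \<Rightarrow> real"
  assumes "mono F" and "\<And>x. F (x + 1) = F x + 1" and "of_int i \<le> (F ^^ j) 0"
  shows "of_int (int l * i) \<le> (F ^^ (l * j)) 0"
proof (induction l)
  case (Suc l)
  have "of_int (int (Suc l) * i) \<le> (F ^^ j) 0 + of_int (int l * i)"
    using assms(3) by (simp add: algebra_simps)
  also have "\<dots> = (F ^^ j) (0 + of_int (int l * i))"
    using degree_one_funpow_shift[of F, OF assms(2), of j 0 "int l * i"] by simp
  also have "\<dots> \<le> (F ^^ j) ((F ^^ (l * j)) 0)"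
    using Suc funpow_mono[OF assms(1)] by simp
  finally show ?case
    by (simp add: funpow_add)
qed simp

lemma funpow_mult_upper:
  fixes F :: "real \<Rightarrow> real"
  assumes "mono F" and "\<And>x. F (x + 1) = F x + 1" and "(F ^^ j) 0 \<le> of_int i"
  shows "(F ^^ (l * j)) 0 \<le> of_int (int l * i)"
proof (induction l)
  case (Suc l)
  have "(F ^^ (Suc l * j)) 0 = (F ^^ j) ((F ^^ (l * j)) 0)"
    by (simp add: funpow_add)
  also have "\<dots> \<le> (F ^^ j) (0 + of_int (int l * i))"
    using Suc funpow_mono[OF assms(1)] by simp
  also have "\<dots> = (F ^^ j) 0 + of_int (int l * i)"
    using degree_one_funpow_shift[of F, OF assms(2), of j 0 "int l * i"] by simp
  also have "\<dots> \<le> of_int (int (Suc l) * i)"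
    using assms(3) by (simp add: algebra_simps)
  finally show ?case .
qed simp

lemma separating_number_exists:
  fixes f g :: "'a \<Rightarrow> real"
  assumes "I \<noteq> {}" and "\<And>i j. i \<in> I \<Longrightarrow> j \<in> I \<Longrightarrow> f i \<le> g j"
  obtains c where "\<And>i. i \<in> I \<Longrightarrow> f i \<le> c" "\<And>i. i \<in> I \<Longrightarrow> c \<le> g i"
proof (rule that[of "SUP i\<in>I. f i"])
  obtain j where "j \<in> I"
    using assms(1) by blast
  then have "bdd_above (f ` I)"
    using assms(2) by (intro bdd_aboveI[where M = "g j"]) auto
  then show "f i \<le> (SUP i\<in>I. f i)" if "i \<in> I" for i
    using that by (rule cSUP_upper2) auto
  show "(SUP i\<in>I. f i) \<le> g i" if "i \<in> I" for i
    using assms that by (intro cSUP_least) auto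
qed

text \<open>
  The bounds on \<open>F ^^ j\<close> at 0 propagate to multiples of \<open>j\<close>. Comparing at the common multiple
  \<open>i * j\<close> shows that the lower approximations \<open>\<lfloor>(F ^^ i) 0\<rfloor> / i\<close> lie below the upper ones
  \<open>(\<lfloor>(F ^^ j) 0\<rfloor> + 1) / j\<close>. The number \<open>\<theta>\<close> separating them is the rotation number of \<open>F\<close>.
  Unlike its definition as the limit of \<open>(F ^^ j) 0 / j\<close>, this gives bounds without error terms.
\<close>

lemma rotation_number_exists:
  fixes F :: "real \<Rightarrow> real"
  assumes F: "mono F" "\<And>x. F (x + 1) = F x + 1"
  obtains \<theta> where "\<And>j. of_int \<lfloor>(F ^^ j) 0\<rfloor> \<le> real j * \<theta>"
    "\<And>j. real j * \<theta> \<le> of_int \<lfloor>(F ^^ j) 0\<rfloor> + 1"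
proof -
  define w where "w j = \<lfloor>(F ^^ j) 0\<rfloor>" for j
  have "of_int (w i) / real i \<le> (of_int (w j) + 1) / real j" if "i \<in> {1..}" "j \<in> {1..}" for i j
  proof -
    have "of_int (int j * w i) \<le> (F ^^ (j * i)) 0"
      by (rule funpow_mult_lower[OF F]) (simp add: w_def)
    also have "\<dots> = (F ^^ (i * j)) 0"
      by (simp add: mult.commute)
    also have "\<dots> \<le> of_int (int i * (w j + 1))"
      by (rule funpow_mult_upper[OF F]) (simp add: w_def; linarith)
    finally show ?thesis
      using that by (simp add: field_simps)
  qed
  then obtain \<theta> where \<theta>: "\<And>i. i \<in> {1..} \<Longrightarrow> of_int (w i) / real i \<le> \<theta>"
      "\<And>i. i \<in> {1..} \<Longrightarrow> \<theta> \<le> (of_int (w i) + 1) / real i"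
    using separating_number_exists[of "{1::nat..}" "\<lambda>i. of_int (w i) / real i" "\<lambda>i. (of_int (w i) + 1) / real i"]
    by (metis atLeast_iff empty_iff order_refl)
  have "of_int (w j) \<le> real j * \<theta> \<and> real j * \<theta> \<le> of_int (w j) + 1" for j
  proof (cases "j = 0")
    case False
    then show ?thesis
      using \<theta>[of j] by (simp add: field_simps)
  qed (simp add: w_def)
  then show thesis
    using that unfolding w_def by blast
qed

lemma floor_funpow_diff:
  fixes F :: "real \<Rightarrow> real"
  assumes F: "mono F" "\<And>x. F (x + 1) = F x + 1"
  shows "\<lfloor>(F ^^ n) x\<rfloor> + \<lfloor>(F ^^ j) 0\<rfloor> \<le> \<lfloor>(F ^^ (n + j)) x\<rfloor>"
    and "\<lfloor>(F ^^ (n + j)) x\<rfloor> \<le> \<lfloor>(F ^^ n) x\<rfloor> + 1 + \<lfloor>(F ^^ j) 0\<rfloor>"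
proof -
  define z where "z = (F ^^ n) x"
  have eq: "(F ^^ (n + j)) x = (F ^^ j) z"
    unfolding z_def by (subst add.commute) (simp add: funpow_add)
  have "(F ^^ j) (0 + of_int \<lfloor>z\<rfloor>) \<le> (F ^^ j) z"
    by (intro funpow_mono[OF F(1)]) simp
  then show "\<lfloor>z\<rfloor> + \<lfloor>(F ^^ j) 0\<rfloor> \<le> \<lfloor>(F ^^ (n + j)) x\<rfloor>"
    unfolding degree_one_funpow_shift[of F, OF F(2)] eq by linarith
  have "(F ^^ j) z \<le> (F ^^ j) (0 + of_int (\<lfloor>z\<rfloor> + 1))"
    by (intro funpow_mono[OF F(1)]) (simp; linarith)
  then show "\<lfloor>(F ^^ (n + j)) x\<rfloor> \<le> \<lfloor>z\<rfloor> + 1 + \<lfloor>(F ^^ j) 0\<rfloor>"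
    unfolding degree_one_funpow_shift[of F, OF F(2)] eq by linarith
qed

text \<open>
  Again a separation argument. By monotonicity the growth of the integer part between times \<open>n\<close> and
  \<open>m\<close> differs from \<open>(m - n) * \<theta>\<close> by at most 1, which says that each \<open>\<lfloor>(F ^^ n) x\<rfloor> - n * \<theta>\<close> is
  below each \<open>\<lfloor>(F ^^ m) x\<rfloor> + 1 - m * \<theta>\<close>.
\<close>

lemma floors_close_to_line:
  fixes F :: "real \<Rightarrow> real"
  assumes F: "mono F" "\<And>x. F (x + 1) = F x + 1"
    and lower: "\<And>j. of_int \<lfloor>(F ^^ j) 0\<rfloor> \<le> real j * \<theta>"
    and upper: "\<And>j. real j * \<theta> \<le> of_int \<lfloor>(F ^^ j) 0\<rfloor> + 1"
  obtains y where "\<And>n. of_int \<lfloor>(F ^^ n) x\<rfloor> \<le> y + real n * \<theta>"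
    "\<And>n. y + real n * \<theta> \<le> of_int \<lfloor>(F ^^ n) x\<rfloor> + 1"
proof -
  define k where "k n = \<lfloor>(F ^^ n) x\<rfloor>" for n
  have "of_int (k n) - real n * \<theta> \<le> of_int (k m) + 1 - real m * \<theta>" for n m
  proof (cases "n \<le> m")
    case True
    then have "k n + \<lfloor>(F ^^ (m - n)) 0\<rfloor> \<le> k m"
      using floor_funpow_diff(1)[OF F, where n = n and j = "m - n"] by (simp add: k_def)
    moreover have "real m * \<theta> - real n * \<theta> \<le> of_int \<lfloor>(F ^^ (m - n)) 0\<rfloor> + 1"
      using upper[of "m - n"] True by (simp add: of_nat_diff left_diff_distrib)
    ultimately show ?thesis
      by linarith
  next
    case False
    then have "k n \<le> k m + 1 + \<lfloor>(F ^^ (n - m)) 0\<rfloor>"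
      using floor_funpow_diff(2)[OF F, where n = m and j = "n - m"] by (simp add: k_def)
    moreover have "of_int \<lfloor>(F ^^ (n - m)) 0\<rfloor> \<le> real n * \<theta> - real m * \<theta>"
      using lower[of "n - m"] False by (simp add: of_nat_diff left_diff_distrib)
    ultimately show ?thesis
      by linarith
  qed
  then obtain y where "\<And>n. of_int (k n) - real n * \<theta> \<le> y" "\<And>n. y \<le> of_int (k n) + 1 - real n * \<theta>"
    using separating_number_exists[of UNIV "\<lambda>n. of_int (k n) - real n * \<theta>" "\<lambda>n. of_int (k n) + 1 - real n * \<theta>"]
    by (metis UNIV_I UNIV_not_empty)
  then show thesis
    using that[of y] by (simp add: k_def algebra_simps)
qed

text \<open>
  The two bounds determine \<open>k n\<close> as the floor of \<open>y + n * \<theta>\<close> except when that number is an integer,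
  which an irrational \<open>\<theta>\<close> allows for one \<open>n\<close> at most.
\<close>

lemma codes_eventually_rotation_irrational:
  assumes "\<theta> \<notin> \<rat>"
    and "\<And>n. of_int (k n) \<le> y + real n * \<theta>" and "\<And>n. y + real n * \<theta> \<le> of_int (k n) + 1"
  shows "\<exists>N. \<forall>n\<ge>N. k n = \<lfloor>y + real n * \<theta>\<rfloor>"
proof -
  have unique: "n = m" if "y + real n * \<theta> = of_int i" "y + real m * \<theta> = of_int l" for n m i l
  proof (rule ccontr)
    assume "n \<noteq> m"
    have "(real n - real m) * \<theta> = of_int (i - l)"
      using that by (simp add: algebra_simps)
    then have "\<theta> = of_int (i - l) / (real n - real m)"
      using \<open>n \<noteq> m\<close> by (simp add: field_simps)
    also have "\<dots> \<in> \<rat>"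
      by (intro Rats_divide Rats_diff Rats_of_int Rats_of_nat)
    finally show False
      using assms(1) by blast
  qed
  obtain N where N: "\<And>n. n \<ge> N \<Longrightarrow> y + real n * \<theta> \<noteq> of_int (k n) + 1"
  proof (cases "\<exists>m. y + real m * \<theta> = of_int (k m) + 1")
    case True
    then obtain m where "y + real m * \<theta> = of_int (k m + 1)"
      by auto
    then show thesis
      using that[of "Suc m"] unique by (metis Suc_n_not_le_n of_int_1 of_int_add)
  qed (use that in blast)
  have "k n = \<lfloor>y + real n * \<theta>\<rfloor>" if "n \<ge> N" for n
    using assms(2)[of n] assms(3)[of n] N[OF that] by linarith
  then show ?thesis
    by blast
qed

text \<open>
  For \<open>\<theta> = p / q\<close> the number \<open>y + n * \<theta>\<close> is an integer for no \<open>n\<close> or for a full residue class modulo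
  \<open>q\<close>, and each such time the integer part may take the upper or the lower of two values. One of
  these choices persists: if \<open>p \<le> (F ^^ q) 0\<close>, a point at or above an integer \<open>i\<close> is sent by
  \<open>F ^^ q\<close> to a point at or above \<open>i + p\<close>, and otherwise a point below \<open>i\<close> is sent below \<open>i + p\<close>. So
  eventually the same choice is always made.
\<close>

lemma codes_eventually_rotation_rational:
  fixes F :: "real \<Rightarrow> real" and p q :: int
  assumes F: "mono F" "\<And>x. F (x + 1) = F x + 1"
    and q: "q > 0" and cop: "coprime p q" and \<theta>: "\<theta> = of_int p / of_int q"
    and k: "\<And>n. k n = \<lfloor>(F ^^ n) x\<rfloor>"
    and lower: "\<And>n. of_int (k n) \<le> y + real n * \<theta>"
    and upper: "\<And>n. y + real n * \<theta> \<le> of_int (k n) + 1"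
  shows "\<exists>y N. \<forall>n\<ge>N. k n = \<lfloor>y + real n * \<theta>\<rfloor>"
proof -
  define P where "P n \<longleftrightarrow> y + real n * \<theta> = of_int (k n)" for n
  define Q where "Q n \<longleftrightarrow> y + real n * \<theta> = of_int (k n) + 1" for n
  have period: "real (n + nat q) * \<theta> = real n * \<theta> + of_int p" for n
    using q by (simp add: \<theta> field_simps)
  have step: "(F ^^ (n + nat q)) x = (F ^^ nat q) ((F ^^ n) x)" for n
    by (subst add.commute) (simp add: funpow_add)
  have resonance: "q dvd int m - int n" if "P n \<or> Q n" "P m \<or> Q m" for m n
  proof -
    obtain i l where "y + real n * \<theta> = of_int i" "y + real m * \<theta> = of_int l"
      using \<open>P n \<or> Q n\<close> \<open>P m \<or> Q m\<close> unfolding P_def Q_def by (metis of_int_1 of_int_add)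
    then have "(real m - real n) * \<theta> = of_int (l - i)"
      by (simp add: algebra_simps)
    then have "of_int ((int m - int n) * p) = (of_int ((l - i) * q) :: real)"
      using q by (simp add: \<theta> field_simps)
    then have "(int m - int n) * p = (l - i) * q"
      unfolding of_int_eq_iff .
    then show ?thesis
      using cop by (metis coprime_commute coprime_dvd_mult_left_iff dvd_triv_right)
  qed
  have absorb: "R m"
    if R: "\<And>n. R n \<Longrightarrow> R (n + nat q)" and "R n0" "n0 \<le> m" "q dvd int m - int n0" for R m n0
  proof -
    obtain c where c: "int m - int n0 = q * c"
      using \<open>q dvd int m - int n0\<close> by blast
    have "c \<ge> 0"
      using c q \<open>n0 \<le> m\<close> by (metis mult_less_cancel_left_pos mult_zero_right of_nat_mono diff_ge_0_iff_ge leD leI)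
    have "int m = int (n0 + nat c * nat q)"
      using c q \<open>c \<ge> 0\<close> by (simp add: mult.commute)
    then have "m = n0 + nat c * nat q"
      unfolding of_nat_eq_iff .
    moreover have "R (n0 + i * nat q)" for i
      by (induction i) (use R \<open>R n0\<close> in \<open>auto simp: add_ac\<close>, metis R add.assoc add.commute)
    ultimately show ?thesis
      by simp
  qed
  have "\<exists>N. (\<forall>n\<ge>N. \<not> P n) \<or> (\<forall>n\<ge>N. \<not> Q n)"
  proof (cases "of_int p \<le> (F ^^ nat q) 0")
    case True
    have "P (n + nat q)" if "P n" for n
    proof -
      have "(F ^^ nat q) (0 + of_int (k n)) \<le> (F ^^ (n + nat q)) x"
        unfolding step by (intro funpow_mono[OF F(1)]) (simp add: k)
      then have "k n + p \<le> k (n + nat q)"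
        using True unfolding degree_one_funpow_shift[of F, OF F(2)] k[of "n + nat q"] by linarith
      then show ?thesis
        using \<open>P n\<close> lower[of "n + nat q"] unfolding P_def period by linarith
    qed
    then have "\<not> Q m" if "P n" "n \<le> m" for n m
      using absorb[of P n m] resonance[of n m] that unfolding P_def Q_def by fastforce
    then show ?thesis
      by (metis le_cases)
  next
    case False
    have "Q (n + nat q)" if "Q n" for n
    proof -
      have "(F ^^ (n + nat q)) x \<le> (F ^^ nat q) (0 + of_int (k n + 1))"
        unfolding step by (intro funpow_mono[OF F(1)]) (simp add: k; linarith)
      then have "k (n + nat q) < k n + 1 + p"
        using False unfolding degree_one_funpow_shift[of F, OF F(2)] k[of "n + nat q"] by linarith
      then show ?thesis
        using \<open>Q n\<close> upper[of "n + nat q"] unfolding Q_def period by linarith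
    qed
    then have "\<not> P m" if "Q n" "n \<le> m" for n m
      using absorb[of Q n m] resonance[of n m] that unfolding P_def Q_def by fastforce
    then show ?thesis
      by (metis le_cases)
  qed
  \<comment> \<open>If Q stops occurring, the floor of the given line is right. If P does, the line has to be moved
     down slightly; below, its offset is replaced by the largest multiple of 1 / q less than y.\<close>
  then consider N where "\<And>n. n \<ge> N \<Longrightarrow> \<not> Q n" | N where "\<And>n. n \<ge> N \<Longrightarrow> \<not> P n"
    by blast
  then show ?thesis
  proof cases
    case 1
    have "k n = \<lfloor>y + real n * \<theta>\<rfloor>" if "n \<ge> N" for n
      using 1[OF that] lower[of n] upper[of n] unfolding Q_def by linarith
    then show ?thesis
      by blast
  next
    case 2
    define j where "j = \<lceil>of_int q * y\<rceil> - 1"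
    have "k n = \<lfloor>of_int j / of_int q + real n * \<theta>\<rfloor>" if "n \<ge> N" for n
    proof -
      have "of_int (k n) < y + real n * \<theta>"
        using 2[OF that] lower[of n] unfolding P_def by linarith
      then have "of_int (q * k n - int n * p) < of_int q * y"
        using q by (simp add: \<theta> field_simps)
      then have low: "q * k n \<le> j + int n * p"
        unfolding j_def by linarith
      have "of_int q * y \<le> of_int (q * k n + q - int n * p)"
        using upper[of n] q by (simp add: \<theta> field_simps)
      then have high: "j + int n * p < q * k n + q"
        unfolding j_def by linarith
      have "of_int j / of_int q + real n * \<theta> = of_int (j + int n * p) / (of_int q :: real)"
        by (simp add: \<theta> add_divide_distrib)
      also have "\<lfloor>\<dots>\<rfloor> = (j + int n * p) div q"
        by (rule floor_divide_of_int_eq)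
      also have "\<dots> = k n"
        using low high by (intro int_div_pos_eq[where r = "j + int n * p - q * k n"]) auto
      finally show ?thesis
        by simp
    qed
    then show ?thesis
      by blast
  qed
qed

lemma monotone_lift_codes:
  fixes F :: "real \<Rightarrow> real"
  assumes F: "mono F" "\<And>x. F (x + 1) = F x + 1"
  obtains \<theta> where "\<And>x. \<exists>y N. \<forall>n\<ge>N. \<lfloor>(F ^^ n) x\<rfloor> = \<lfloor>y + real n * \<theta>\<rfloor>"
proof -
  obtain \<theta> where \<theta>: "\<And>j. of_int \<lfloor>(F ^^ j) 0\<rfloor> \<le> real j * \<theta>"
      "\<And>j. real j * \<theta> \<le> of_int \<lfloor>(F ^^ j) 0\<rfloor> + 1"
    using rotation_number_exists[OF F] by metis
  have "\<exists>y N. \<forall>n\<ge>N. \<lfloor>(F ^^ n) x\<rfloor> = \<lfloor>y + real n * \<theta>\<rfloor>" for x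
  proof -
    obtain y where y: "\<And>n. of_int \<lfloor>(F ^^ n) x\<rfloor> \<le> y + real n * \<theta>"
        "\<And>n. y + real n * \<theta> \<le> of_int \<lfloor>(F ^^ n) x\<rfloor> + 1"
      using floors_close_to_line[OF F \<theta>] by metis
    show ?thesis
    proof (cases "\<theta> \<in> \<rat>")
      case True
      then obtain p q where "q > 0" "coprime p q" "\<theta> = of_int p / of_int q"
        by (rule Rats_cases') 
      then show ?thesis
        using codes_eventually_rotation_rational[OF F _ _ _ refl y] by blast
    next
      case False
      then show ?thesis
        using codes_eventually_rotation_irrational[OF _ y] by blast
    qed
  qed
  then show thesis
    using that by blast
qed

section \<open>Orbits coded by a rotation\<close>

definition floor_jump :: "real \<Rightarrow> real \<Rightarrow> real" where
  "floor_jump \<theta> t = of_int (\<lfloor>t + \<theta>\<rfloor> - \<lfloor>t\<rfloor>)"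

text \<open>
  Formally \<open>coded_orbit\<close> solves \<open>\<Psi> (t + \<theta>) = lam * \<Psi> t + c - h * floor_jump \<theta> t\<close> by iteration
  backwards along the rotation. For \<open>0 < \<theta> < 1\<close> the jump is the indicator of the times at which the
  branch \<open>lam * x + (c - h)\<close> is used instead of \<open>lam * x + c\<close>.
\<close>

definition coded_orbit :: "real \<Rightarrow> real \<Rightarrow> real \<Rightarrow> real \<Rightarrow> real \<Rightarrow> real" where
  "coded_orbit lam c h \<theta> t = (\<Sum>k. lam ^ k * (c - h * floor_jump \<theta> (t - real (Suc k) * \<theta>)))"

lemma coded_orbit_term_bound:
  assumes "0 < lam"
  shows "norm (lam ^ k * (c - h * floor_jump \<theta> t)) \<le> lam ^ k * (\<bar>c\<bar> + \<bar>h\<bar> * (\<bar>\<theta>\<bar> + 1))"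
proof -
  have "\<bar>floor_jump \<theta> t\<bar> \<le> \<bar>\<theta>\<bar> + 1"
    unfolding floor_jump_def by linarith
  then have "\<bar>h * floor_jump \<theta> t\<bar> \<le> \<bar>h\<bar> * (\<bar>\<theta>\<bar> + 1)"
    by (simp add: abs_mult mult_left_mono)
  then have "\<bar>c - h * floor_jump \<theta> t\<bar> \<le> \<bar>c\<bar> + \<bar>h\<bar> * (\<bar>\<theta>\<bar> + 1)"
    by linarith
  then show ?thesis
    using assms by (simp add: abs_mult)
qed

lemma summable_geometric_mult:
  fixes lam :: real
  assumes "0 < lam" "lam < 1"
  shows "summable (\<lambda>k. lam ^ k * B)"
  using assms by (intro summable_mult2 summable_geometric) simp

lemma summable_coded_orbit:
  fixes lam :: real
  assumes "0 < lam" "lam < 1"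
  shows "summable (\<lambda>k. lam ^ k * (c - h * floor_jump \<theta> (t k)))"
  using summable_geometric_mult[OF assms] coded_orbit_term_bound[OF assms(1)]
  by (rule summable_comparison_test'[where N = 0])

lemma coded_orbit_bounded:
  assumes "0 < lam" "lam < 1"
  shows "bounded (range (coded_orbit lam c h \<theta>))"
proof (rule boundedI)
  fix x assume "x \<in> range (coded_orbit lam c h \<theta>)"
  then obtain t where x: "x = coded_orbit lam c h \<theta> t"
    by blast
  show "norm x \<le> (\<Sum>k. lam ^ k * (\<bar>c\<bar> + \<bar>h\<bar> * (\<bar>\<theta>\<bar> + 1)))"
    unfolding x coded_orbit_def
    by (rule norm_suminf_le[OF coded_orbit_term_bound[OF assms(1)] summable_geometric_mult[OF assms]])
qed

lemma coded_orbit_recursion: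
  assumes "0 < lam" "lam < 1"
  shows "coded_orbit lam c h \<theta> (t + \<theta>) = lam * coded_orbit lam c h \<theta> t + (c - h * floor_jump \<theta> t)"
proof -
  define f where "f k = lam ^ k * (c - h * floor_jump \<theta> (t + \<theta> - real (Suc k) * \<theta>))" for k
  have f: "summable f"
    unfolding f_def by (rule summable_coded_orbit[OF assms])
  have "f (Suc k) = lam * (lam ^ k * (c - h * floor_jump \<theta> (t - real (Suc k) * \<theta>)))" for k
    by (simp add: f_def algebra_simps)
  then have "(\<Sum>k. f (Suc k)) = lam * coded_orbit lam c h \<theta> t"
    unfolding coded_orbit_def using summable_coded_orbit[OF assms] by (simp add: suminf_mult)
  moreover have "f 0 = c - h * floor_jump \<theta> t"
    by (simp add: f_def)
  moreover have "coded_orbit lam c h \<theta> (t + \<theta>) = suminf f"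
    unfolding coded_orbit_def f_def ..
  ultimately show ?thesis
    using suminf_split_head[OF f] by simp
qed

lemma coded_orbit_periodic:
  "coded_orbit lam c h \<theta> (t + of_int m) = coded_orbit lam c h \<theta> t"
proof -
  have "floor_jump \<theta> (t + of_int m - s) = floor_jump \<theta> (t - s)" for s
  proof -
    have "t + of_int m - s = (t - s) + of_int m" "t + of_int m - s + \<theta> = (t - s + \<theta>) + of_int m"
      by simp_all
    then show ?thesis
      unfolding floor_jump_def by (simp only: floor_add_int[symmetric])
  qed
  then show ?thesis
    by (simp add: coded_orbit_def)
qed

text \<open>
  This is what reduces the asymptotics of an orbit to its code: only the driving terms \<open>w\<close> have to
  agree, the states need not be close to begin with.
\<close>

lemma contraction_recursions_merge:
  fixes x z w :: "nat \<Rightarrow> real"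
  assumes "0 < lam" "lam < 1"
    and "\<And>n. n \<ge> N \<Longrightarrow> x (Suc n) = lam * x n + w n"
    and "\<And>n. n \<ge> N \<Longrightarrow> z (Suc n) = lam * z n + w n"
  shows "(\<lambda>n. x n - z n) \<longlonglongrightarrow> 0"
proof -
  have "x (n + N) - z (n + N) = lam ^ n * (x N - z N)" for n
  proof (induction n)
    case (Suc n)
    have "x (Suc n + N) - z (Suc n + N) = lam * (x (n + N) - z (n + N))"
      by (simp add: assms(3,4) right_diff_distrib)
    then show ?case
      by (simp add: Suc)
  qed simp
  moreover have "(\<lambda>n. lam ^ n * (x N - z N)) \<longlonglongrightarrow> 0"
    using assms(1,2) by (intro tendsto_mult_left_zero LIMSEQ_realpow_zero) auto
  ultimately have "(\<lambda>n. x (n + N) - z (n + N)) \<longlonglongrightarrow> 0"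
    by simp
  then show ?thesis
    by (rule LIMSEQ_offset)
qed

text \<open>
  Only integer parts of points \<open>y + i * p / q\<close> enter, so \<open>y\<close> may be rounded down to a multiple
  \<open>j / q\<close>. As \<open>p\<close> is invertible modulo \<open>q\<close>, such a point is \<open>s * \<theta>\<close> up to an integer.
\<close>

lemma coded_orbit_rational:
  fixes p q :: int
  assumes "q > 0" "coprime p q" and \<theta>: "\<theta> = of_int p / of_int q"
  obtains s where "\<And>n. coded_orbit lam c h \<theta> (y + real n * \<theta>) = coded_orbit lam c h \<theta> (real (n + s) * \<theta>)"
proof -
  define j where "j = \<lfloor>of_int q * y\<rfloor>"
  have floor_grid: "\<lfloor>y + of_int i * \<theta>\<rfloor> = \<lfloor>of_int j / of_int q + of_int i * \<theta>\<rfloor>" for i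
  proof -
    have "y + of_int i * \<theta> = (of_int q * y + of_int (i * p)) / of_int q"
      using \<open>q > 0\<close> by (simp add: \<theta> field_simps)
    then have "\<lfloor>y + of_int i * \<theta>\<rfloor> = \<lfloor>of_int q * y + of_int (i * p)\<rfloor> div q"
      using \<open>q > 0\<close> floor_divide_real_eq_div[of q "of_int q * y + of_int (i * p)"] by simp
    also have "\<dots> = (j + i * p) div q"
      unfolding j_def by (subst floor_add_int[symmetric]) (rule refl)
    also have "\<dots> = \<lfloor>of_int (j + i * p) / of_int q :: real\<rfloor>"
      by (rule floor_divide_of_int_eq[symmetric])
    also have "of_int (j + i * p) / of_int q = of_int j / of_int q + of_int i * \<theta>"
      by (simp add: \<theta> add_divide_distrib)
    finally show ?thesis .
  qed
  have grid: "coded_orbit lam c h \<theta> (y + real n * \<theta>) = coded_orbit lam c h \<theta> (of_int j / of_int q + real n * \<theta>)" for n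
  proof -
    have "floor_jump \<theta> (y + real n * \<theta> - real (Suc k) * \<theta>) = floor_jump \<theta> (of_int j / of_int q + real n * \<theta> - real (Suc k) * \<theta>)" for k
      using floor_grid[of "int n - int k"] floor_grid[of "int n - int (Suc k)"]
      by (simp add: floor_jump_def algebra_simps)
    then show ?thesis
      by (simp add: coded_orbit_def)
  qed
  obtain u v where uv: "u * p + v * q = 1"
    using bezout_int[of p q] \<open>coprime p q\<close> by (auto simp: coprime_iff_gcd_eq_1)
  define s where "s = nat ((j * u) mod q)"
  define m where "m = - (j * v) - (j * u) div q * p"
  have "int s = j * u - (j * u) div q * q"
    using \<open>q > 0\<close> by (simp add: s_def minus_div_mult_eq_mod)
  then have "int s * p = j * (u * p) - (j * u) div q * q * p"
    by (simp add: left_diff_distrib)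
  also have "u * p = 1 - v * q"
    using uv by simp
  finally have "int s * p = j + q * m"
    by (simp add: m_def algebra_simps)
  then have "real s * of_int p = of_int j + of_int q * (of_int m :: real)"
    by (metis of_int_add of_int_mult of_int_of_nat_eq)
  then have "of_int j / of_int q + real n * \<theta> + of_int m = real (n + s) * \<theta>" for n
    using \<open>q > 0\<close> by (simp add: \<theta> field_simps)
  then have "coded_orbit lam c h \<theta> (y + real n * \<theta>) = coded_orbit lam c h \<theta> (real (n + s) * \<theta>)" for n
    using grid coded_orbit_periodic by metis
  then show thesis
    using that by blast
qed

lemma eventually_floor_right: "eventually (\<lambda>s. \<lfloor>s - b\<rfloor> = \<lfloor>t - b\<rfloor>) (at_right (t::real))"
proof (rule eventually_at_rightI)
  show "t < b + of_int \<lfloor>t - b\<rfloor> + 1"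
    by linarith
  show "\<lfloor>s - b\<rfloor> = \<lfloor>t - b\<rfloor>" if "s \<in> {t<..<b + of_int \<lfloor>t - b\<rfloor> + 1}" for s
    using that by simp linarith
qed

text \<open>
  Each term of the series is locally constant to the right of \<open>t\<close>, as \<open>floor\<close> is, and the geometric
  bound lets the limit pass under the sum.
\<close>

lemma coded_orbit_right_continuous:
  assumes "0 < lam" "lam < 1"
  shows "(coded_orbit lam c h \<theta> \<longlongrightarrow> coded_orbit lam c h \<theta> t) (at_right t)"
proof -
  define a where "a k s = lam ^ k * (c - h * floor_jump \<theta> (s - real (Suc k) * \<theta>))" for k s
  have "((\<lambda>s. suminf (\<lambda>k. a k s)) \<longlongrightarrow> suminf (\<lambda>k. a k t)) (at_right t)"
  proof (intro conjunct2[OF conjunct2[OF tannerys_theorem]])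
    show "(a k \<longlongrightarrow> a k t) (at_right t)" for k
    proof (rule tendsto_eventually)
      show "eventually (\<lambda>s. a k s = a k t) (at_right t)"
        using eventually_floor_right[of "real (Suc k) * \<theta>" t] eventually_floor_right[of "real (Suc k) * \<theta> - \<theta>" t]
        by eventually_elim (simp add: a_def floor_jump_def algebra_simps)
    qed
    show "eventually (\<lambda>(k, s). norm (a k s) \<le> lam ^ k * (\<bar>c\<bar> + \<bar>h\<bar> * (\<bar>\<theta>\<bar> + 1))) (sequentially \<times>\<^sub>F at_right t)"
      unfolding a_def by (intro always_eventually) (auto intro: coded_orbit_term_bound[OF assms(1), simplified])
    show "summable (\<lambda>k. lam ^ k * (\<bar>c\<bar> + \<bar>h\<bar> * (\<bar>\<theta>\<bar> + 1)))"
      by (rule summable_geometric_mult[OF assms])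
  qed simp
  then show ?thesis
    by (simp add: a_def coded_orbit_def[abs_def])
qed

text \<open>
  Kronecker's theorem with hitting times beyond any bound: approximate the midpoint of the interval
  shifted back by \<open>N\<close> rotation steps.
\<close>

lemma irrational_rotation_hits:
  assumes "\<theta> \<notin> \<rat>" "\<alpha> < \<beta>"
  obtains n :: nat and m :: int where "n \<ge> N" "\<alpha> < real n * \<theta> + of_int m" "real n * \<theta> + of_int m < \<beta>"
proof -
  obtain i k :: int where "k > 0" and *: "\<bar>of_int k * \<theta> - of_int i - ((\<alpha> + \<beta>) / 2 - real N * \<theta>)\<bar> < (\<beta> - \<alpha>) / 2"
    using sequence_of_fractional_parts_is_dense[OF assms(1), of "(\<beta> - \<alpha>) / 2"] assms(2) by (metis diff_gt_0_iff_gt half_gt_zero)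
  have "real (N + nat k) * \<theta> + of_int (- i) = of_int k * \<theta> - of_int i + real N * \<theta>"
    using \<open>k > 0\<close> by (simp add: algebra_simps)
  then show thesis
    using * by (intro that[of "N + nat k" "- i"]) (simp_all only: abs_less_iff, simp_all add: field_simps)
qed

text \<open>
  Let \<open>d k\<close> count the integers in the interval from \<open>s - k * \<theta>\<close> to \<open>t - k * \<theta>\<close>, open on the left
  and closed on the right. The jumps are differences of consecutive integer parts, so Abel summation
  turns the difference of the values into \<open>h * (1 - lam)\<close> times the sum of \<open>lam ^ k * d (Suc k)\<close>;
  no boundary term appears because \<open>d 0 = 0\<close>, both points lying in \<open>[0, 1)\<close>. All terms are
  nonnegative, and one is positive because the rotation orbit of 0 is dense modulo one and so visits
  the interval between \<open>s\<close> and \<open>t\<close>.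
\<close>

lemma coded_orbit_strict_mono:
  assumes lam: "0 < lam" "lam < 1" and "h > 0" and "\<theta> \<notin> \<rat>" and st: "0 \<le> s" "s < t" "t < 1"
  shows "coded_orbit lam c h \<theta> s < coded_orbit lam c h \<theta> t"
proof -
  define d where "d k = (of_int (\<lfloor>t - real k * \<theta>\<rfloor> - \<lfloor>s - real k * \<theta>\<rfloor>) :: real)" for k
  have d_nonneg: "d k \<ge> 0" for k
    using st(2) by (simp add: d_def floor_mono)
  have "d k \<le> 2" for k
    using st unfolding d_def by linarith
  then have bound: "norm (lam ^ k * d (g k)) \<le> lam ^ k * 2" for k and g :: "nat \<Rightarrow> nat"
    using d_nonneg[of "g k"] lam by (simp add: abs_mult)
  have sum: "summable (\<lambda>k. lam ^ k * d (g k))" for g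
    by (rule summable_comparison_test'[OF summable_geometric_mult[OF lam] bound])
  have "d 0 = 0"
    using st floor_eq_iff[of s 0] floor_eq_iff[of t 0] by (simp add: d_def)
  have "coded_orbit lam c h \<theta> t - coded_orbit lam c h \<theta> s
      = (\<Sum>k. lam ^ k * (c - h * floor_jump \<theta> (t - real (Suc k) * \<theta>))
            - lam ^ k * (c - h * floor_jump \<theta> (s - real (Suc k) * \<theta>)))"
    unfolding coded_orbit_def by (rule suminf_diff) (rule summable_coded_orbit[OF lam])+
  also have "\<dots> = (\<Sum>k. h * (lam ^ k * d (Suc k) - lam ^ k * d k))"
    by (intro suminf_cong) (simp add: floor_jump_def d_def algebra_simps)
  also have "\<dots> = h * ((\<Sum>k. lam ^ k * d (Suc k)) - (\<Sum>k. lam ^ k * d k))"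
    using sum[of Suc] sum[of id] by (simp add: suminf_mult suminf_diff summable_diff)
  also have "(\<Sum>k. lam ^ k * d k) = lam * (\<Sum>k. lam ^ k * d (Suc k))"
    using suminf_split_head[OF sum[of id]] \<open>d 0 = 0\<close> suminf_mult[OF sum[of Suc], of lam]
    by (simp add: mult_ac)
  finally have diff: "coded_orbit lam c h \<theta> t - coded_orbit lam c h \<theta> s = h * (1 - lam) * (\<Sum>k. lam ^ k * d (Suc k))"
    by (simp add: algebra_simps)
  obtain n m where nm: "n \<ge> 1" "s < real n * \<theta> + of_int m" "real n * \<theta> + of_int m < t"
    using irrational_rotation_hits[OF \<open>\<theta> \<notin> \<rat>\<close> st(2)] .
  have "\<lfloor>s - real n * \<theta>\<rfloor> < m" "m \<le> \<lfloor>t - real n * \<theta>\<rfloor>"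
    using nm by linarith+
  then have "d n > 0"
    by (simp add: d_def)
  moreover have "d (Suc (n - 1)) = d n"
    using nm(1) by simp
  ultimately have "(\<Sum>k. lam ^ k * d (Suc k)) > 0"
    using lam d_nonneg by (intro suminf_pos2[OF sum[of Suc], of "n - 1"]) auto
  then have "coded_orbit lam c h \<theta> t - coded_orbit lam c h \<theta> s > 0"
    unfolding diff using lam(2) \<open>h > 0\<close> by (intro mult_pos_pos) simp_all
  then show ?thesis
    by simp
qed

section \<open>The limit set for an irrational rotation number\<close>

lemma omega_limit_set_iff:
  "p \<in> omega_limit_set S \<longleftrightarrow> (\<forall>\<epsilon>>0. \<forall>N. \<exists>n\<ge>N. \<bar>S n - p\<bar> < \<epsilon>)"
proof
  assume "p \<in> omega_limit_set S"
  then obtain r where r: "strict_mono r" "(\<lambda>k. S (r k)) \<longlonglongrightarrow> p"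
    unfolding omega_limit_set_def by blast
  show "\<forall>\<epsilon>>0. \<forall>N. \<exists>n\<ge>N. \<bar>S n - p\<bar> < \<epsilon>"
  proof (intro allI impI)
    fix \<epsilon> :: real and N
    assume "\<epsilon> > 0"
    then obtain K where "\<And>k. k \<ge> K \<Longrightarrow> \<bar>S (r k) - p\<bar> < \<epsilon>"
      using r(2) unfolding LIMSEQ_iff real_norm_def by blast
    then have "\<bar>S (r (max K N)) - p\<bar> < \<epsilon>" "r (max K N) \<ge> N"
      using seq_suble[OF r(1), of "max K N"] by auto
    then show "\<exists>n\<ge>N. \<bar>S n - p\<bar> < \<epsilon>"
      by blast
  qed
next
  assume rec: "\<forall>\<epsilon>>0. \<forall>N. \<exists>n\<ge>N. \<bar>S n - p\<bar> < \<epsilon>"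
  have pick: "\<exists>m>n. \<bar>S m - p\<bar> < inverse (real (Suc k))" for n k
    using rec[rule_format, of "inverse (real (Suc k))" "Suc n"] by (auto simp: Suc_le_eq)
  have "\<exists>r. \<forall>k. \<bar>S (r k) - p\<bar> < inverse (real (Suc k)) \<and> r k < r (Suc k)"
    using pick by (intro dependent_nat_choice) blast+
  then obtain r where r: "\<And>k. \<bar>S (r k) - p\<bar> < inverse (real (Suc k))" "\<And>k. r k < r (Suc k)"
    by blast
  have "(\<lambda>k. S (r k) - p) \<longlonglongrightarrow> 0"
    using LIMSEQ_inverse_real_of_nat by (rule Lim_null_comparison[rotated]) (use r(1) in \<open>auto intro!: always_eventually less_imp_le\<close>)
  then have "(\<lambda>k. S (r k)) \<longlonglongrightarrow> p"
    by (simp add: LIM_zero_iff)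
  then show "p \<in> omega_limit_set S"
    using r(2) strict_mono_Suc_iff unfolding omega_limit_set_def by blast
qed

text \<open>
  For the inclusion from right to left, \<open>\<Psi> t\<close> is approximated through times \<open>n\<close> at which
  \<open>y + n * \<theta>\<close> is, modulo one, slightly larger than \<open>t\<close>. The side matters: in general \<open>\<Psi>\<close> is only
  continuous from the right.
\<close>

lemma omega_limit_set_coded_orbit:
  assumes lam: "0 < lam" "lam < 1" and irr: "\<theta> \<notin> \<rat>"
    and asym: "(\<lambda>n. S n - coded_orbit lam c h \<theta> (y + real n * \<theta>)) \<longlonglongrightarrow> 0"
  shows "omega_limit_set S = closure (range (coded_orbit lam c h \<theta>))"
proof -
  let ?\<Psi> = "coded_orbit lam c h \<theta>"
  have asym': "\<exists>N. \<forall>n\<ge>N. \<bar>S n - ?\<Psi> (y + real n * \<theta>)\<bar> < \<epsilon>" if "\<epsilon> > 0" for \<epsilon>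
    using asym that unfolding LIMSEQ_iff by simp
  show ?thesis
  proof (intro set_eqI iffI)
    fix p assume p: "p \<in> omega_limit_set S"
    show "p \<in> closure (range ?\<Psi>)"
      unfolding closure_approachable
    proof (intro allI impI)
      fix \<epsilon> :: real assume "\<epsilon> > 0"
      then obtain N where N: "\<And>n. n \<ge> N \<Longrightarrow> \<bar>S n - ?\<Psi> (y + real n * \<theta>)\<bar> < \<epsilon> / 2"
        using asym'[of "\<epsilon> / 2"] by auto
      obtain n where "n \<ge> N" "\<bar>S n - p\<bar> < \<epsilon> / 2"
        using p \<open>\<epsilon> > 0\<close> unfolding omega_limit_set_iff by (meson half_gt_zero)
      then have "dist (?\<Psi> (y + real n * \<theta>)) p < \<epsilon>"
        using N[of n] unfolding dist_real_def by linarith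
      then show "\<exists>x\<in>range ?\<Psi>. dist x p < \<epsilon>"
        by blast
    qed
  next
    fix p assume p: "p \<in> closure (range ?\<Psi>)"
    show "p \<in> omega_limit_set S"
      unfolding omega_limit_set_iff
    proof (intro allI impI)
      fix \<epsilon> :: real and N assume "\<epsilon> > 0"
      then have \<epsilon>: "\<epsilon> / 3 > 0"
        by simp
      obtain t where t: "\<bar>?\<Psi> t - p\<bar> < \<epsilon> / 3"
        using p \<epsilon> unfolding closure_approachable dist_real_def by blast
      have "eventually (\<lambda>s. dist (?\<Psi> s) (?\<Psi> t) < \<epsilon> / 3) (at_right t)"
        using coded_orbit_right_continuous[OF lam] \<epsilon> by (rule tendstoD)
      then obtain u where u: "t < u" "\<And>s. t < s \<Longrightarrow> s < u \<Longrightarrow> \<bar>?\<Psi> s - ?\<Psi> t\<bar> < \<epsilon> / 3"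
        unfolding eventually_at_right_field dist_real_def by blast
      obtain M where M: "\<And>n. n \<ge> M \<Longrightarrow> \<bar>S n - ?\<Psi> (y + real n * \<theta>)\<bar> < \<epsilon> / 3"
        using asym'[OF \<epsilon>] by auto
      obtain n m where n: "n \<ge> max N M" "t - y < real n * \<theta> + of_int m" "real n * \<theta> + of_int m < u - y"
        using irrational_rotation_hits[OF irr, of "t - y" "u - y"] u(1) by (metis diff_strict_right_mono)
      have "\<bar>?\<Psi> (y + real n * \<theta> + of_int m) - ?\<Psi> t\<bar> < \<epsilon> / 3"
        using n by (intro u(2)) simp_all
      then have "\<bar>S n - p\<bar> < \<epsilon>"
        using t M[of n] n(1) unfolding coded_orbit_periodic by linarith
      then show "\<exists>n\<ge>N. \<bar>S n - p\<bar> < \<epsilon>"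
        using n(1) by auto
    qed
  qed
qed

lemma closure_range_coded_orbit_perfect:
  assumes lam: "0 < lam" "lam < 1" and "h > 0" and irr: "\<theta> \<notin> \<rat>"
    and x: "x \<in> closure (range (coded_orbit lam c h \<theta>))"
  shows "x islimpt closure (range (coded_orbit lam c h \<theta>))"
proof -
  let ?\<Psi> = "coded_orbit lam c h \<theta>"
  have "?\<Psi> t islimpt range ?\<Psi>" for t
    unfolding islimpt_approachable
  proof (intro allI impI)
    fix \<epsilon> :: real assume "\<epsilon> > 0"
    have "?\<Psi> t = ?\<Psi> (frac t)"
      using coded_orbit_periodic[of lam c h \<theta> "frac t" "\<lfloor>t\<rfloor>"] by (simp add: frac_def)
    have "eventually (\<lambda>s. dist (?\<Psi> s) (?\<Psi> (frac t)) < \<epsilon>) (at_right (frac t))"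
      using coded_orbit_right_continuous[OF lam] \<open>\<epsilon> > 0\<close> by (rule tendstoD)
    then obtain u where u: "frac t < u" "\<And>s. frac t < s \<Longrightarrow> s < u \<Longrightarrow> dist (?\<Psi> s) (?\<Psi> (frac t)) < \<epsilon>"
      unfolding eventually_at_right_field by blast
    obtain s where s: "frac t < s" "s < min u 1"
      using dense[of "frac t" "min u 1"] u(1) frac_lt_1[of t] by auto
    have "?\<Psi> (frac t) < ?\<Psi> s"
      using s by (intro coded_orbit_strict_mono[OF lam \<open>h > 0\<close> irr]) auto
    then have "?\<Psi> s \<noteq> ?\<Psi> t" "dist (?\<Psi> s) (?\<Psi> t) < \<epsilon>"
      using u(2)[of s] s \<open>?\<Psi> t = ?\<Psi> (frac t)\<close> by auto
    then show "\<exists>x'\<in>range ?\<Psi>. x' \<noteq> ?\<Psi> t \<and> dist x' (?\<Psi> t) < \<epsilon>"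
      by blast
  qed
  then show ?thesis
    using x unfolding limpt_of_closure by (auto simp: closure_def)
qed

text \<open>
  The two pieces of \<open>K\<close> overlap in one point at most, so their measures add up to that of \<open>K\<close>, and
  the covering gives \<open>measure K \<le> lam * measure K\<close>.
\<close>

lemma negligible_of_contracted_pieces:
  fixes K :: "real set"
  assumes "compact K" and lam: "0 < lam" "lam < 1"
    and cover: "K \<subseteq> (\<lambda>x. lam * x + v1) ` (K \<inter> {..\<rho>}) \<union> (\<lambda>x. lam * x + v2) ` (K \<inter> {\<rho>..})"
  shows "negligible K"
proof -
  have image: "compact ((\<lambda>x. lam * x + v) ` A)"
      "measure lebesgue ((\<lambda>x. lam * x + v) ` A) = lam * measure lebesgue A" if "compact A" for A v
    using measure_lebesgue_affine[of lam v A] lam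
    by (auto intro!: compact_continuous_image continuous_intros that)
  have pieces: "compact (K \<inter> {..\<rho>})" "compact (K \<inter> {\<rho>..})"
    by (auto intro: compact_Int_closed \<open>compact K\<close>)
  let ?A = "(\<lambda>x. lam * x + v1) ` (K \<inter> {..\<rho>})" and ?B = "(\<lambda>x. lam * x + v2) ` (K \<inter> {\<rho>..})"
  note meas = lmeasurable_compact[OF \<open>compact K\<close>] lmeasurable_compact[OF pieces(1)] lmeasurable_compact[OF pieces(2)]
    lmeasurable_compact[OF image(1)[OF pieces(1), of v1]] lmeasurable_compact[OF image(1)[OF pieces(2), of v2]]
  have "measure lebesgue K \<le> measure lebesgue (?A \<union> ?B)"
    using cover meas by (intro measure_mono_fmeasurable) auto
  also have "\<dots> \<le> measure lebesgue ?A + measure lebesgue ?B"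
    using meas by (intro measure_Un_le) auto
  also have "\<dots> = lam * (measure lebesgue (K \<inter> {..\<rho>}) + measure lebesgue (K \<inter> {\<rho>..}))"
    by (simp add: image(2) pieces distrib_left)
  also have "measure lebesgue (K \<inter> {..\<rho>}) + measure lebesgue (K \<inter> {\<rho>..}) = measure lebesgue K"
  proof -
    have "negligible ((K \<inter> {..\<rho>}) \<inter> (K \<inter> {\<rho>..}))"
      by (rule negligible_subset[of "{\<rho>}"]) auto
    then have "measure lebesgue ((K \<inter> {..\<rho>}) \<inter> (K \<inter> {\<rho>..})) = 0"
      using negligible_iff_measure by blast
    moreover have "(K \<inter> {..\<rho>}) \<union> (K \<inter> {\<rho>..}) = K"
      by auto
    ultimately show ?thesis
      using measure_Un3[OF meas(2,3)] by simp
  qed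
  finally have "(1 - lam) * measure lebesgue K \<le> 0"
    by (simp add: algebra_simps)
  then have "measure lebesgue K = 0"
    using lam measure_nonneg[of lebesgue K] by (simp add: mult_le_0_iff)
  then show ?thesis
    using meas(1) negligible_iff_measure by blast
qed

text \<open>
  A limit point \<open>p\<close> is the limit of the images of the preceding states. Pass to a subsequence along
  which these converge, to some \<open>p'\<close>, and stay on one side of \<open>\<rho>\<close>; there the map is a single affine
  branch. Only non-strict inequalities survive for \<open>p'\<close>, and this is why \<open>\<rho>\<close> belongs to both
  pieces.
\<close>

lemma omega_limit_set_self_cover:
  assumes S: "S = financial_series r \<rho> v1 v2 S0" and "bounded (range S)"
  defines "K \<equiv> omega_limit_set S"
  shows "K \<subseteq> (\<lambda>x. (1 + r) * x + v1) ` (K \<inter> {..\<rho>}) \<union> (\<lambda>x. (1 + r) * x + v2) ` (K \<inter> {\<rho>..})"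
proof
  fix p assume "p \<in> K"
  then obtain n where n: "strict_mono n" "(\<lambda>k. S (n k)) \<longlonglongrightarrow> p"
    unfolding K_def omega_limit_set_def by blast
  define T where "T k = S (n (Suc k) - 1)" for k
  have pos: "n (Suc k) > 0" for k
    using strict_monoD[OF n(1), of k "Suc k"] by simp
  have image: "S (n (Suc k)) = wealth_map r \<rho> v1 v2 (T k)" for k
  proof -
    obtain i where "n (Suc k) = Suc i"
      using pos[of k] gr0_conv_Suc by auto
    then show ?thesis
      by (simp add: T_def S)
  qed
  have "bounded (range T)"
    by (rule bounded_subset[OF \<open>bounded (range S)\<close>]) (auto simp: T_def)
  then obtain p' s where s: "strict_mono s" "(T \<circ> s) \<longlonglongrightarrow> p'"
    using bounded_imp_convergent_subsequence by blast
  have "strict_mono (\<lambda>k. n (Suc (s k)) - 1)"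
  proof (rule strict_monoI)
    fix i j :: nat assume "i < j"
    then have "n (Suc (s i)) < n (Suc (s j))"
      using strict_monoD[OF s(1)] strict_monoD[OF n(1)] by blast
    then show "n (Suc (s i)) - 1 < n (Suc (s j)) - 1"
      using pos[of "s i"] by linarith
  qed
  then have "p' \<in> K"
    using s(2) unfolding K_def omega_limit_set_def T_def comp_def by blast
  have limit: "(\<lambda>k. T (s (u k))) \<longlonglongrightarrow> p'" if "strict_mono u" for u
    using LIMSEQ_subseq_LIMSEQ[OF s(2) that] by (simp add: comp_def)
  have side: "p = (1 + r) * p' + v" if u: "strict_mono u"
      and v: "\<And>k. wealth_map r \<rho> v1 v2 (T (s (u k))) = (1 + r) * T (s (u k)) + v" for u :: "nat \<Rightarrow> nat" and v
  proof (rule LIMSEQ_unique)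
    have "strict_mono (\<lambda>k. Suc (s (u k)))"
      using u s(1) unfolding strict_mono_def by simp
    then show "(\<lambda>k. S (n (Suc (s (u k))))) \<longlonglongrightarrow> p"
      using LIMSEQ_subseq_LIMSEQ[OF n(2)] by (simp add: comp_def)
    show "(\<lambda>k. S (n (Suc (s (u k))))) \<longlonglongrightarrow> (1 + r) * p' + v"
      unfolding image v by (intro tendsto_intros limit[OF u])
  qed
  show "p \<in> (\<lambda>x. (1 + r) * x + v1) ` (K \<inter> {..\<rho>}) \<union> (\<lambda>x. (1 + r) * x + v2) ` (K \<inter> {\<rho>..})"
  proof (cases "infinite {k. T (s k) < \<rho>}")
    case True
    then obtain u :: "nat \<Rightarrow> nat" where u: "strict_mono u" "\<And>k. T (s (u k)) < \<rho>"
      using infinite_enumerate[of "{k. T (s k) < \<rho>}"] by auto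
    have "p = (1 + r) * p' + v1"
      by (rule side[OF u(1)]) (simp add: wealth_map_def u(2))
    moreover have "p' \<le> \<rho>"
      by (rule LIMSEQ_le_const2[OF limit[OF u(1)]]) (auto intro: less_imp_le u(2))
    ultimately show ?thesis
      using \<open>p' \<in> K\<close> by blast
  next
    case False
    then have "infinite (- {k. T (s k) < \<rho>})"
      by (simp add: Compl_eq_Diff_UNIV)
    then obtain u :: "nat \<Rightarrow> nat" where u: "strict_mono u" "\<And>k. \<rho> \<le> T (s (u k))"
      using infinite_enumerate[of "- {k. T (s k) < \<rho>}"] by (auto simp: not_less)
    have "p = (1 + r) * p' + v2"
      by (rule side[OF u(1)]) (simp add: wealth_map_def u(2) flip: not_le)
    moreover have "\<rho> \<le> p'"
      by (rule LIMSEQ_le_const[OF limit[OF u(1)]]) (auto intro: u(2))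
    ultimately show ?thesis
      using \<open>p' \<in> K\<close> by blast
  qed
qed

section \<open>Orbits that settle on one side of the discontinuity\<close>

lemma affine_recursion_tendsto:
  fixes x :: "nat \<Rightarrow> real"
  assumes r: "- 1 < r" "r < 0" and x: "\<And>n. n \<ge> N \<Longrightarrow> x (Suc n) = (1 + r) * x n + v"
  shows "x \<longlonglongrightarrow> v / (- r)"
proof (rule LIM_zero_cancel)
  show "(\<lambda>n. x n - v / (- r)) \<longlonglongrightarrow> 0"
  proof (rule contraction_recursions_merge)
    show "v / (- r) = (1 + r) * (v / (- r)) + v"
      using r by (simp add: field_simps)
  qed (use r x in auto)
qed

lemma financial_series_tendsto_fixed_point:
  assumes r: "- 1 < r" "r < 0" and S: "S = financial_series r \<rho> v1 v2 S0"
  shows "(\<And>n. n \<ge> N \<Longrightarrow> S n < \<rho>) \<Longrightarrow> S \<longlonglongrightarrow> v1 / (- r)"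
    and "(\<And>n. n \<ge> N \<Longrightarrow> \<rho> \<le> S n) \<Longrightarrow> S \<longlonglongrightarrow> v2 / (- r)"
  by (rule affine_recursion_tendsto[OF r, of N]; simp add: S wealth_map_def not_less[symmetric])+

text \<open>
  Either hypothesis makes one side of \<open>\<rho>\<close> invariant. An orbit that enters this side stays there, and
  any other orbit always stays on the opposite side.
\<close>

lemma financial_series_eventually_one_sided:
  assumes "- 1 < r" and inv: "(1 + r) * \<rho> + v1 \<le> \<rho> \<or> \<rho> \<le> (1 + r) * \<rho> + v2"
    and S: "S = financial_series r \<rho> v1 v2 S0"
  obtains N where "\<And>n. n \<ge> N \<Longrightarrow> S n < \<rho>" | N where "\<And>n. n \<ge> N \<Longrightarrow> \<rho> \<le> S n"
proof -
  have below: "S m < \<rho>" if "(1 + r) * \<rho> + v1 \<le> \<rho>" "S n < \<rho>" "n \<le> m" for n m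
    using \<open>n \<le> m\<close>
  proof (induction m rule: dec_induct)
    case (step m)
    have "(1 + r) * S m < (1 + r) * \<rho>"
      using step.IH \<open>- 1 < r\<close> by simp
    then show ?case
      using that(1) step.IH by (simp add: S wealth_map_def)
  qed (fact \<open>S n < \<rho>\<close>)
  have above: "\<rho> \<le> S m" if "\<rho> \<le> (1 + r) * \<rho> + v2" "\<rho> \<le> S n" "n \<le> m" for n m
    using \<open>n \<le> m\<close>
  proof (induction m rule: dec_induct)
    case (step m)
    have "(1 + r) * \<rho> \<le> (1 + r) * S m"
      using step.IH \<open>- 1 < r\<close> by simp
    then show ?case
      using that(1) step.IH by (simp add: S wealth_map_def)
  qed (fact \<open>\<rho> \<le> S n\<close>)
  show thesis
    using inv below above that by (metis leD leI le_refl zero_le)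
qed

text \<open>
  The fixed point of each branch lies on the other side of \<open>\<rho>\<close>, so an orbit cannot remain on one
  side. The first state after a crossing from below to above lies in the interval.
\<close>

lemma financial_series_enters_trap:
  assumes r: "- 1 < r" "r < 0" and up: "\<rho> < (1 + r) * \<rho> + v1" and down: "(1 + r) * \<rho> + v2 < \<rho>"
  obtains N where "financial_series r \<rho> v1 v2 S0 N \<in> {(1 + r) * \<rho> + v2..<(1 + r) * \<rho> + v1}"
proof -
  define S where "S = financial_series r \<rho> v1 v2 S0"
  have "\<exists>n. S n < \<rho>"
  proof (rule ccontr)
    assume "\<not> (\<exists>n. S n < \<rho>)"
    then have ge: "\<And>n. n \<ge> 0 \<Longrightarrow> \<rho> \<le> S n"
      by (simp add: not_less)
    have "S \<longlonglongrightarrow> v2 / (- r)"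
      using financial_series_tendsto_fixed_point(2)[OF r S_def ge] .
    then have "\<rho> \<le> v2 / (- r)"
      using ge by (intro LIMSEQ_le_const) auto
    then show False
      using down r by (simp add: field_simps)
  qed
  then obtain n where "S n < \<rho>"
    by blast
  have "\<exists>m\<ge>n. \<rho> \<le> S m"
  proof (rule ccontr)
    assume "\<not> (\<exists>m\<ge>n. \<rho> \<le> S m)"
    then have less: "\<And>m. m \<ge> n \<Longrightarrow> S m < \<rho>"
      using not_le by blast
    have "S \<longlonglongrightarrow> v1 / (- r)"
      using financial_series_tendsto_fixed_point(1)[OF r S_def less] .
    then have "v1 / (- r) \<le> \<rho>"
      using less by (intro LIMSEQ_le_const2) (auto intro: less_imp_le)
    then show False
      using up r by (simp add: field_simps)
  qed
  then obtain m where "m \<ge> n" "\<rho> \<le> S m"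
    by blast
  have "\<exists>k. S k < \<rho> \<and> \<rho> \<le> S (Suc k)"
  proof (rule ccontr)
    assume no_crossing: "\<not> (\<exists>k. S k < \<rho> \<and> \<rho> \<le> S (Suc k))"
    have "S k < \<rho>" if "n \<le> k" for k
      using that by (induction k rule: dec_induct) (use \<open>S n < \<rho>\<close> no_crossing in \<open>auto simp: not_le\<close>)
    then show False
      using \<open>m \<ge> n\<close> \<open>\<rho> \<le> S m\<close> by force
  qed
  then obtain k where k: "S k < \<rho>" "\<rho> \<le> S (Suc k)"
    by blast
  have "(1 + r) * S k < (1 + r) * \<rho>"
    using k(1) r by simp
  then have "S (Suc k) < (1 + r) * \<rho> + v1"
    using k(1) by (simp add: S_def wealth_map_def)
  then show thesis
    using that[of "Suc k"] k(2) down by (simp add: S_def)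
qed

section \<open>Orbits that keep crossing the discontinuity\<close>

text \<open>
  The map in the coordinate \<open>x\<close> with \<open>X = a + (b - a) * frac x\<close>, where \<open>a\<close> is the value of the map at
  \<open>\<rho>\<close> and \<open>b\<close> its limit from the left there. Crossing \<open>\<rho>\<close> becomes passing an integer, so the
  discontinuity at \<open>\<rho>\<close> disappears in the lift, and the integers are where \<open>a\<close> and \<open>b\<close> are glued.
\<close>

definition wealth_lift :: "real \<Rightarrow> real \<Rightarrow> real \<Rightarrow> real" where
  "wealth_lift lam \<delta> x = lam * x + (1 - lam) * of_int \<lfloor>x\<rfloor> + \<delta>"

lemma wealth_lift_mono:
  assumes "0 < lam" "lam < 1"
  shows "mono (wealth_lift lam \<delta>)"
  using assms by (intro monoI) (auto simp: wealth_lift_def intro!: add_mono mult_left_mono floor_mono)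

lemma wealth_lift_add_one: "wealth_lift lam \<delta> (x + 1) = wealth_lift lam \<delta> x + 1"
  by (simp add: wealth_lift_def algebra_simps)

text \<open>
  The second equation expresses the choice of the branch by the integer part of the lift: the integer
  part increases by one exactly when \<open>X\<close> is at least \<open>\<rho>\<close>. The constant \<open>\<delta>\<close> is the coordinate of
  the image of \<open>a\<close>, to which the lower branch applies since \<open>a < \<rho>\<close>.
\<close>

lemma wealth_map_lift:
  fixes r \<rho> v1 v2 :: real
  defines "a \<equiv> (1 + r) * \<rho> + v2" and "b \<equiv> (1 + r) * \<rho> + v1"
  defines "\<delta> \<equiv> ((1 + r) * a + v1 - a) / (b - a)"
  assumes r: "- 1 < r" "r < 0" and up: "\<rho> < b" and down: "a < \<rho>"
    and X: "X = a + (b - a) * frac x"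
  shows "wealth_map r \<rho> v1 v2 X = a + (b - a) * frac (wealth_lift (1 + r) \<delta> x)"
    and "wealth_map r \<rho> v1 v2 X
      = (1 + r) * X + (v1 - (v1 - v2) * of_int (\<lfloor>wealth_lift (1 + r) \<delta> x\<rfloor> - \<lfloor>x\<rfloor>))"
proof -
  have ba: "b - a = v1 - v2" "b - a > 0"
    using up down by (auto simp: a_def b_def)
  define w where "w = (b - a) * frac x"
  have "0 \<le> w"
    using ba(2) by (simp add: w_def)
  moreover have "w < b - a"
    using mult_strict_left_mono[OF frac_lt_1 ba(2), of x] unfolding w_def mult_1_right .
  moreover have "X = a + w"
    unfolding w_def by (rule X)
  ultimately have X_range: "a \<le> X" "X < b"
    by linarith+
  define W where "W = wealth_map r \<rho> v1 v2 X"
  define j :: int where "j = (if X < \<rho> then 0 else 1)"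
  have W: "W = (1 + r) * X + (v1 - (v1 - v2) * of_int j)"
    by (simp add: W_def j_def wealth_map_def)
  have W_range: "a \<le> W" "W < b"
  proof -
    have "a \<le> W \<and> W < b"
    proof (cases "X < \<rho>")
      case True
      have "- r * \<rho> < v1"
        using up by (simp add: b_def algebra_simps)
      moreover have "- r * X < - r * \<rho>"
        using True r by (intro mult_strict_left_mono) auto
      moreover have "(1 + r) * X < (1 + r) * \<rho>"
        using True r by simp
      ultimately show ?thesis
        using True X_range by (simp add: W_def wealth_map_def b_def algebra_simps)
    next
      case False
      have "v2 < - r * \<rho>"
        using down by (simp add: a_def algebra_simps)
      moreover have "- r * \<rho> \<le> - r * X"
        using False r by (intro mult_left_mono) auto
      moreover have "(1 + r) * \<rho> \<le> (1 + r) * X"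
        using False r by simp
      ultimately show ?thesis
        using False X_range by (simp add: W_def wealth_map_def a_def algebra_simps)
    qed
    then show "a \<le> W" "W < b"
      by auto
  qed
  have "(b - a) * \<delta> = (1 + r) * a + v1 - a"
    using ba(2) by (simp add: \<delta>_def)
  moreover have "wealth_lift (1 + r) \<delta> x = of_int \<lfloor>x\<rfloor> + (1 + r) * frac x + \<delta>"
    by (simp add: wealth_lift_def frac_def algebra_simps)
  ultimately have "(b - a) * (wealth_lift (1 + r) \<delta> x - of_int \<lfloor>x\<rfloor> - of_int j) = W - a"
    unfolding W X ba(1)[symmetric] by (simp add: algebra_simps)
  then have lift: "wealth_lift (1 + r) \<delta> x - of_int (\<lfloor>x\<rfloor> + j) = (W - a) / (b - a)"
    using ba(2) by (simp add: field_simps)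
  have "0 \<le> (W - a) / (b - a)" "(W - a) / (b - a) < 1"
    using W_range ba(2) by simp_all
  then have floor: "\<lfloor>wealth_lift (1 + r) \<delta> x\<rfloor> = \<lfloor>x\<rfloor> + j"
    unfolding lift[symmetric] by linarith
  show "W = (1 + r) * X + (v1 - (v1 - v2) * of_int (\<lfloor>wealth_lift (1 + r) \<delta> x\<rfloor> - \<lfloor>x\<rfloor>))"
    unfolding floor W by simp
  have "frac (wealth_lift (1 + r) \<delta> x) = (W - a) / (b - a)"
    unfolding frac_def floor by (rule lift)
  then show "W = a + (b - a) * frac (wealth_lift (1 + r) \<delta> x)"
    using ba(2) by simp
qed

text \<open>
  Once in the interval, the orbit satisfies the affine recursion driven by the increments of the
  integer parts of its lift. Eventually these are the increments of a rotation, which drive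
  \<open>coded_orbit\<close> as well, and the two recursions merge. The entrance time is absorbed into the phase
  \<open>y\<close>.
\<close>

lemma financial_series_asymptotic_coded_orbit:
  assumes r: "- 1 < r" "r < 0" and up: "\<rho> < (1 + r) * \<rho> + v1" and down: "(1 + r) * \<rho> + v2 < \<rho>"
  obtains \<theta> where "\<And>S0. \<exists>y. (\<lambda>n. financial_series r \<rho> v1 v2 S0 n
      - coded_orbit (1 + r) v1 (v1 - v2) \<theta> (y + real n * \<theta>)) \<longlonglongrightarrow> 0"
proof -
  define a b where "a = (1 + r) * \<rho> + v2" and "b = (1 + r) * \<rho> + v1"
  define F where "F = wealth_lift (1 + r) (((1 + r) * a + v1 - a) / (b - a))"
  have lam: "0 < 1 + r" "1 + r < 1"
    using r by auto
  have ba: "b - a > 0"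
    using up down by (simp add: a_def b_def)
  obtain \<theta> where \<theta>: "\<And>x. \<exists>y N. \<forall>n\<ge>N. \<lfloor>(F ^^ n) x\<rfloor> = \<lfloor>y + real n * \<theta>\<rfloor>"
    using monotone_lift_codes[of F] wealth_lift_mono[OF lam] wealth_lift_add_one unfolding F_def by metis
  let ?\<Psi> = "coded_orbit (1 + r) v1 (v1 - v2) \<theta>"
  have "\<exists>y. (\<lambda>n. financial_series r \<rho> v1 v2 S0 n - ?\<Psi> (y + real n * \<theta>)) \<longlonglongrightarrow> 0" for S0
  proof -
    obtain M where M: "financial_series r \<rho> v1 v2 S0 M \<in> {a..<b}"
      using financial_series_enters_trap[OF r up down] unfolding a_def b_def .
    define T where "T n = financial_series r \<rho> v1 v2 S0 (M + n)" for n
    define x where "x = (T 0 - a) / (b - a)"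
    have T_Suc: "T (Suc n) = wealth_map r \<rho> v1 v2 (T n)" for n
      by (simp add: T_def)
    have "0 \<le> x" "x < 1"
      using M ba by (simp_all add: x_def T_def)
    then have "frac x = x"
      by (simp add: frac_eq)
    have lift: "T n = a + (b - a) * frac ((F ^^ n) x)" for n
    proof (induction n)
      case 0
      then show ?case
        using ba \<open>frac x = x\<close> by (simp add: x_def)
    next
      case (Suc n)
      then show ?case
        unfolding T_Suc
        using wealth_map_lift(1)[OF r up down, folded a_def b_def, of "T n" "(F ^^ n) x"]
        by (simp add: F_def)
    qed
    obtain y N where yN: "\<And>n. n \<ge> N \<Longrightarrow> \<lfloor>(F ^^ n) x\<rfloor> = \<lfloor>y + real n * \<theta>\<rfloor>"
      using \<theta> by metis
    have "(\<lambda>n. T n - ?\<Psi> (y + real n * \<theta>)) \<longlonglongrightarrow> 0"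
    proof (rule contraction_recursions_merge[OF lam])
      fix n assume "n \<ge> N"
      show "?\<Psi> (y + real (Suc n) * \<theta>) = (1 + r) * ?\<Psi> (y + real n * \<theta>)
          + (v1 - (v1 - v2) * floor_jump \<theta> (y + real n * \<theta>))"
        using coded_orbit_recursion[OF lam, of v1 "v1 - v2" \<theta> "y + real n * \<theta>"] by (simp add: algebra_simps)
      have "y + real n * \<theta> + \<theta> = y + real (Suc n) * \<theta>"
        by (simp add: algebra_simps)
      then have "floor_jump \<theta> (y + real n * \<theta>) = of_int (\<lfloor>F ((F ^^ n) x)\<rfloor> - \<lfloor>(F ^^ n) x\<rfloor>)"
        using yN[of n] yN[of "Suc n"] \<open>n \<ge> N\<close> unfolding floor_jump_def by (simp only: funpow.simps comp_def le_SucI)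
      then show "T (Suc n) = (1 + r) * T n + (v1 - (v1 - v2) * floor_jump \<theta> (y + real n * \<theta>))"
        unfolding T_Suc
        using wealth_map_lift(2)[OF r up down, folded a_def b_def, OF lift[of n]]
        by (simp add: F_def)
    qed
    moreover have "(y - real M * \<theta>) + real (n + M) * \<theta> = y + real n * \<theta>" for n
      by (simp add: algebra_simps)
    ultimately have "(\<lambda>n. financial_series r \<rho> v1 v2 S0 (n + M)
        - ?\<Psi> ((y - real M * \<theta>) + real (n + M) * \<theta>)) \<longlonglongrightarrow> 0"
      by (simp only: T_def add.commute[of M])
    then have "(\<lambda>n. financial_series r \<rho> v1 v2 S0 n - ?\<Psi> ((y - real M * \<theta>) + real n * \<theta>)) \<longlonglongrightarrow> 0"
      by (rule LIMSEQ_offset)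
    then show ?thesis
      by blast
  qed
  then show thesis
    using that by blast
qed

section \<open>The dichotomy\<close>

lemma asymptotic_to_iff: "asymptotic_to b a \<longleftrightarrow> (\<lambda>n. b n - a n) \<longlonglongrightarrow> 0"
  unfolding asymptotic_to_def by (rule tendsto_rabs_zero_iff)

theorem theorem1:
  fixes r \<rho> v1 v2 :: real
  assumes "r \<in> {-1<..<0}" and "\<rho> > 0"
    and "v1 \<ge> 0" and "v2 \<ge> 0" and "v1 \<noteq> v2"
  shows "(\<exists>A :: (nat \<Rightarrow> real) set. finite A \<and> card A \<le> 2 \<and> (\<forall>a\<in>A. periodic_seq a) \<and>
            (\<forall>S0\<ge>0. \<exists>a\<in>A. asymptotic_up_to_shift (financial_series r \<rho> v1 v2 S0) a))
       \<or> (\<exists>C. cantor_set C \<and>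
            (\<forall>S0\<ge>0. omega_limit_set (financial_series r \<rho> v1 v2 S0) = C))"
proof (cases "(1 + r) * \<rho> + v1 \<le> \<rho> \<or> \<rho> \<le> (1 + r) * \<rho> + v2")
  case True
  have r: "- 1 < r" "r < 0"
    using assms(1) by auto
  define A :: "(nat \<Rightarrow> real) set" where "A = {\<lambda>_. v1 / (- r), \<lambda>_. v2 / (- r)}"
  have "\<exists>a\<in>A. asymptotic_up_to_shift (financial_series r \<rho> v1 v2 S0) a" for S0
  proof (rule financial_series_eventually_one_sided[OF r(1) True refl, of S0])
    fix N assume "\<And>n. n \<ge> N \<Longrightarrow> financial_series r \<rho> v1 v2 S0 n < \<rho>"
    then have "financial_series r \<rho> v1 v2 S0 \<longlonglongrightarrow> v1 / (- r)"
      by (rule financial_series_tendsto_fixed_point(1)[OF r refl])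
    then have "asymptotic_up_to_shift (financial_series r \<rho> v1 v2 S0) (\<lambda>_. v1 / (- r))"
      unfolding asymptotic_up_to_shift_def asymptotic_to_iff by (blast intro: LIM_zero)
    then show ?thesis
      unfolding A_def by blast
  next
    fix N assume "\<And>n. n \<ge> N \<Longrightarrow> \<rho> \<le> financial_series r \<rho> v1 v2 S0 n"
    then have "financial_series r \<rho> v1 v2 S0 \<longlonglongrightarrow> v2 / (- r)"
      by (rule financial_series_tendsto_fixed_point(2)[OF r refl])
    then have "asymptotic_up_to_shift (financial_series r \<rho> v1 v2 S0) (\<lambda>_. v2 / (- r))"
      unfolding asymptotic_up_to_shift_def asymptotic_to_iff by (blast intro: LIM_zero)
    then show ?thesis
      unfolding A_def by blast
  qed
  moreover have "finite A" "card A \<le> 2" "\<forall>a\<in>A. periodic_seq a"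
    by (auto simp: A_def periodic_seq_def card_insert_if)
  ultimately show ?thesis
    by blast
next
  case False
  have lam: "0 < 1 + r" "1 + r < 1" and r: "- 1 < r" "r < 0"
    using assms(1) by auto
  have up: "\<rho> < (1 + r) * \<rho> + v1" and down: "(1 + r) * \<rho> + v2 < \<rho>" and "v1 - v2 > 0"
    using False by auto
  obtain \<theta> where \<theta>: "\<And>S0. \<exists>y. (\<lambda>n. financial_series r \<rho> v1 v2 S0 n
      - coded_orbit (1 + r) v1 (v1 - v2) \<theta> (y + real n * \<theta>)) \<longlonglongrightarrow> 0"
    using financial_series_asymptotic_coded_orbit[OF r up down] by metis
  let ?\<Psi> = "coded_orbit (1 + r) v1 (v1 - v2) \<theta>"
  show ?thesis
  proof (cases "\<theta> \<in> \<rat>")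
    case True
    then obtain p q where pq: "q > 0" "coprime p q" "\<theta> = of_int p / of_int q"
      by (rule Rats_cases')
    define a where "a n = ?\<Psi> (real n * \<theta>)" for n
    have "real (n + nat q) * \<theta> = real n * \<theta> + of_int p" for n
      using pq by (simp add: field_simps)
    then have "a (n + nat q) = a n" for n
      by (simp only: a_def coded_orbit_periodic)
    then have "periodic_seq a"
      using pq(1) unfolding periodic_seq_def by (intro exI[of _ "nat q"]) auto
    moreover have "asymptotic_up_to_shift (financial_series r \<rho> v1 v2 S0) a" for S0
    proof -
      obtain y where y: "(\<lambda>n. financial_series r \<rho> v1 v2 S0 n - ?\<Psi> (y + real n * \<theta>)) \<longlonglongrightarrow> 0"
        using \<theta> by blast
      obtain s where "\<And>n. ?\<Psi> (y + real n * \<theta>) = a (n + s)"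
        using coded_orbit_rational[OF pq] unfolding a_def by metis
      then show ?thesis
        using y unfolding asymptotic_up_to_shift_def asymptotic_to_iff by auto
    qed
    ultimately show ?thesis
      by (intro disjI1 exI[of _ "{a}"]) auto
  next
    case False
    define C where "C = closure (range ?\<Psi>)"
    have omega: "omega_limit_set (financial_series r \<rho> v1 v2 S0) = C" for S0
      using \<theta>[of S0] omega_limit_set_coded_orbit[OF lam False] unfolding C_def by blast
    have "compact C"
      using coded_orbit_bounded[OF lam] by (simp add: C_def compact_closure)
    have "bounded (range (financial_series r \<rho> v1 v2 0))"
    proof -
      obtain y where "(\<lambda>n. financial_series r \<rho> v1 v2 0 n - ?\<Psi> (y + real n * \<theta>)) \<longlonglongrightarrow> 0"
        using \<theta> by blast
      then have "bounded (range (\<lambda>n. financial_series r \<rho> v1 v2 0 n - ?\<Psi> (y + real n * \<theta>)))"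
        by (rule convergent_imp_bounded)
      moreover have "bounded (range (\<lambda>n. ?\<Psi> (y + real n * \<theta>)))"
        by (rule bounded_subset[OF coded_orbit_bounded[OF lam]]) auto
      ultimately have "bounded (range (\<lambda>n. (financial_series r \<rho> v1 v2 0 n - ?\<Psi> (y + real n * \<theta>)) + ?\<Psi> (y + real n * \<theta>)))"
        by (rule bounded_plus_comp)
      then show ?thesis
        by simp
    qed
    from omega_limit_set_self_cover[OF refl this] have "negligible C"
      unfolding omega by (rule negligible_of_contracted_pieces[OF \<open>compact C\<close> lam])
    then have "interior C = {}"
      using negligible_subset[OF _ interior_subset] open_not_negligible[OF open_interior] by blast
    moreover have "closure C = C"
      by (simp add: C_def)
    ultimately have "cantor_set C"
      using \<open>compact C\<close> closure_range_coded_orbit_perfect[OF lam \<open>v1 - v2 > 0\<close> False]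
      unfolding cantor_set_def by (simp add: C_def)
    then show ?thesis
      using omega by blast
  qed
qed

end
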